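(* For every computation $M$ of $\lambda_{\copyright}$, the following are equivalent: (1) $M \to_{\copyright}^* !V$ for some value $V$; (2) $M (\to^{\mathsf w}_{\beta_c})^* !U$ for some value $U$.
   Context: The computational core $\lambda_{\copyright}$ has values $V,W ::= x \mid \lambda x.M$ and computations $M,N,L ::= \,!V \mid VM$ ($x$ ranging over a countable set of variables, terms up to $\alpha$-renaming). Rules: $\beta_c$: $(\lambda x.M)(!V) \mapsto M\{V/x\}$; $\mathsf{id}$: $(\lambda x.!x)M \mapsto M$; $\sigma$: $(\lambda y.N)((\lambda x.M)L) \mapsto (\lambda x.(\lambda y.N)M)L$ provided $x\notin \mathrm{fv}(N)$; $\copyright=\beta_c\cup\mathsf{id}\cup\sigma$. Contexts: $C ::= [\,] \mid\, !(\lambda x.C) \mid VC \mid (\lambda x.C)M$; weak contexts $W ::= [\,]\mid VW$. $\to_\rho$ is closure of rule $\rho$ under all contexts, $\to^{\mathsf w}_\rho$ its closure under weak contexts; $^*$ is reflexive–transitive closure. *)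

theory Defs
  imports Main
begin

text \<open>
  Terms up to alpha-renaming are represented by de Bruijn indices: \<open>Lam M\<close> binds index 0 in
  \<open>M\<close>, and an index that exceeds the number of enclosing binders denotes a free variable
  (countably many are available).  \<open>Ret V\<close> is the computation written \<open>!V\<close>, and \<open>App V M\<close>
  is \<open>V M\<close>.
\<close>

datatype val = Var nat | Lam comp
  and comp = Ret val | App val comp

text \<open>\<open>lift_val V k\<close> and \<open>lift_comp M k\<close> increment all indices that are at least \<open>k\<close>.\<close>

primrec lift_val :: "val \<Rightarrow> nat \<Rightarrow> val"
  and lift_comp :: "comp \<Rightarrow> nat \<Rightarrow> comp"
where
  "lift_val (Var i) k = (if i < k then Var i else Var (i + 1))"
| "lift_val (Lam M) k = Lam (lift_comp M (k + 1))"
| "lift_comp (Ret V) k = Ret (lift_val V k)"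
| "lift_comp (App V M) k = App (lift_val V k) (lift_comp M k)"

text \<open>
  \<open>subst_comp M U k\<close> replaces index \<open>k\<close> by \<open>U\<close> and decrements the indices above \<open>k\<close>, since
  the binder of \<open>k\<close> disappears.  Hence \<open>subst_comp M V 0\<close> is \<open>M{V/x}\<close> for a redex with
  function part \<open>Lam M\<close>.
\<close>

primrec subst_val :: "val \<Rightarrow> val \<Rightarrow> nat \<Rightarrow> val"
  and subst_comp :: "comp \<Rightarrow> val \<Rightarrow> nat \<Rightarrow> comp"
where
  "subst_val (Var i) U k = (if k < i then Var (i - 1) else if i = k then U else Var i)"
| "subst_val (Lam M) U k = Lam (subst_comp M (lift_val U 0) (k + 1))"
| "subst_comp (Ret V) U k = Ret (subst_val V U k)"
| "subst_comp (App V M) U k = App (subst_val V U k) (subst_comp M U k)"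

inductive beta_c :: "comp \<Rightarrow> comp \<Rightarrow> bool" where
  "beta_c (App (Lam M) (Ret V)) (subst_comp M V 0)"

inductive id_rule :: "comp \<Rightarrow> comp \<Rightarrow> bool" where
  "id_rule (App (Lam (Ret (Var 0))) M) M"

text \<open>
  The side condition that \<open>x\<close> is not free in \<open>N\<close> can always be met by renaming; here it
  appears as the lifting of \<open>Lam N\<close> when it moves under the binder of \<open>M\<close>.
\<close>

inductive sigma :: "comp \<Rightarrow> comp \<Rightarrow> bool" where
  "sigma (App (Lam N) (App (Lam M) L)) (App (Lam (App (lift_val (Lam N) 0) M)) L)"

definition core :: "comp \<Rightarrow> comp \<Rightarrow> bool" where
  "core M N \<longleftrightarrow> beta_c M N \<or> id_rule M N \<or> sigma M N"

text \<open>
  The constructors \<open>CRetLam C\<close>, \<open>CApp V C\<close> and \<open>CLam C M\<close> stand for \<open>!(\<lambda>x.C)\<close>,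
  \<open>V C\<close> and \<open>(\<lambda>x.C) M\<close>.  Plugging is not capture-avoiding: the binders of a context bind in
  the plugged computation, so no lifting takes place.
\<close>

datatype ctx = Hole | CRetLam ctx | CApp val ctx | CLam ctx comp

primrec plug :: "ctx \<Rightarrow> comp \<Rightarrow> comp" where
  "plug Hole P = P"
| "plug (CRetLam C) P = Ret (Lam (plug C P))"
| "plug (CApp V C) P = App V (plug C P)"
| "plug (CLam C M) P = App (Lam (plug C P)) M"

inductive weak :: "ctx \<Rightarrow> bool" where
  weak_Hole: "weak Hole"
| weak_CApp: "weak W \<Longrightarrow> weak (CApp V W)"

definition red :: "(comp \<Rightarrow> comp \<Rightarrow> bool) \<Rightarrow> comp \<Rightarrow> comp \<Rightarrow> bool" where
  "red \<rho> M N \<longleftrightarrow> (\<exists>C P Q. \<rho> P Q \<and> M = plug C P \<and> N = plug C Q)"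

definition wred :: "(comp \<Rightarrow> comp \<Rightarrow> bool) \<Rightarrow> comp \<Rightarrow> comp \<Rightarrow> bool" where
  "wred \<rho> M N \<longleftrightarrow> (\<exists>W P Q. weak W \<and> \<rho> P Q \<and> M = plug W P \<and> N = plug W Q)"

end

(* Computations are interpreted in a graph model: a computation denotes the set of finite pieces of
   information (lists of points) about the values it may return.  All three rules preserve the
   interpretation, and the interpretation is compositional, so a computation that reduces to some
   Ret V has a non-empty denotation, as Ret V has.  Conversely a realizability argument shows that a
   computation with non-empty denotation is evaluated to a value by weak beta_c steps alone. *)

theory Submission
  imports Defs
begin

section \<open>The graph model\<close>

text \<open>\<open>Arr a c\<close> is the information that an argument with all the points of \<open>a\<close> is sent to a
  computation returning a value with all the points of \<open>c\<close>; \<open>Arr a []\<close> thus still records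
  convergence.\<close>

datatype point = Arr "point list" "point list"

text \<open>In the clause for \<open>App\<close>, the passage to \<open>set c \<subseteq> set c'\<close> makes the denotation of every
  computation closed under taking less information, which the rule \<open>id_rule\<close> needs.\<close>

primrec den_val :: "val \<Rightarrow> (nat \<Rightarrow> point set) \<Rightarrow> point set"
  and den_comp :: "comp \<Rightarrow> (nat \<Rightarrow> point set) \<Rightarrow> point list set"
where
  "den_val (Var i) = (\<lambda>\<rho>. \<rho> i)"
| "den_val (Lam M) = (\<lambda>\<rho>. {Arr a c | a c. c \<in> den_comp M (case_nat (set a) \<rho>)})"
| "den_comp (Ret V) = (\<lambda>\<rho>. {c. set c \<subseteq> den_val V \<rho>})"
| "den_comp (App V M) =
    (\<lambda>\<rho>. {c. \<exists>a c'. a \<in> den_comp M \<rho> \<and> set c \<subseteq> set c' \<and> Arr a c' \<in> den_val V \<rho>})"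

lemma den_comp_antimono:
  "c \<in> den_comp M \<rho> \<Longrightarrow> set c' \<subseteq> set c \<Longrightarrow> c' \<in> den_comp M \<rho>"
  by (cases M) (simp_all, blast+)

lemma den_mono:
  "\<rho> \<le> \<rho>' \<Longrightarrow> den_val V \<rho> \<subseteq> den_val V \<rho>'"
  "\<rho> \<le> \<rho>' \<Longrightarrow> den_comp M \<rho> \<subseteq> den_comp M \<rho>'"
proof (induction V and M arbitrary: \<rho> \<rho>' and \<rho> \<rho>')
  case (Lam M)
  have "den_comp M (case_nat (set a) \<rho>) \<subseteq> den_comp M (case_nat (set a) \<rho>')" for a
    using Lam.prems by (intro Lam.IH) (auto simp: le_fun_def split: nat.split)
  then show ?case by auto
next
  case (Ret V)
  from Ret.IH[OF Ret.prems] show ?case by auto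
next
  case (App V M)
  from App.IH(1)[OF App.prems] App.IH(2)[OF App.prems] show ?case by auto
qed (simp add: le_fun_def)

lemma den_lift:
  "den_val (lift_val V k) \<rho> = den_val V (\<lambda>i. if i < k then \<rho> i else \<rho> (Suc i))"
  "den_comp (lift_comp M k) \<rho> = den_comp M (\<lambda>i. if i < k then \<rho> i else \<rho> (Suc i))"
proof (induction V and M arbitrary: k \<rho> and k \<rho>)
  case (Lam M)
  have "(\<lambda>i. if i < k + 1 then case_nat A \<rho> i else case_nat A \<rho> (Suc i))
      = case_nat A (\<lambda>i. if i < k then \<rho> i else \<rho> (Suc i))" for A
    by (rule ext) (auto split: nat.split)
  then show ?case by (simp only: lift_val.simps den_val.simps Lam.IH)
qed auto

lemma den_lift_0 [simp]: "den_val (lift_val V 0) (case_nat A \<rho>) = den_val V \<rho>"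
  by (simp add: den_lift)

lemma den_subst:
  "den_val (subst_val V U k) \<rho>
    = den_val V (\<lambda>i. if i < k then \<rho> i else if i = k then den_val U \<rho> else \<rho> (i - 1))"
  "den_comp (subst_comp M U k) \<rho>
    = den_comp M (\<lambda>i. if i < k then \<rho> i else if i = k then den_val U \<rho> else \<rho> (i - 1))"
proof (induction V and M arbitrary: k \<rho> U and k \<rho> U)
  case (Lam M)
  have "(\<lambda>i. if i < k + 1 then case_nat A \<rho> i else if i = k + 1 then den_val U \<rho>
          else case_nat A \<rho> (i - 1))
      = case_nat A (\<lambda>i. if i < k then \<rho> i else if i = k then den_val U \<rho> else \<rho> (i - 1))" for A
    by (rule ext) (auto split: nat.split)
  then show ?case by (simp only: subst_val.simps den_val.simps Lam.IH den_lift_0)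
qed auto

lemma den_subst_0: "den_comp (subst_comp M U 0) \<rho> = den_comp M (case_nat (den_val U \<rho>) \<rho>)"
proof -
  have "(\<lambda>i. if i < 0 then \<rho> i else if i = 0 then den_val U \<rho> else \<rho> (i - 1))
      = case_nat (den_val U \<rho>) \<rho>"
    by (rule ext) (auto split: nat.split)
  then show ?thesis by (simp only: den_subst)
qed

text \<open>Crossing a binder shifts the updated index, which lets inductions over a fixed entry
  \<open>k\<close> pass through \<open>Lam\<close>.\<close>

lemma case_nat_upd: "case_nat A (\<rho>(k := X)) = (case_nat A \<rho>)(Suc k := X)"
  by (rule ext) (auto split: nat.split)

lemma den_upd_mono:
  assumes "X \<subseteq> Y"
  shows "den_val V (\<rho>(k := X)) \<subseteq> den_val V (\<rho>(k := Y))"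
    and "den_comp M (\<rho>(k := X)) \<subseteq> den_comp M (\<rho>(k := Y))"
  using assms by (simp_all add: den_mono le_fun_def)

text \<open>Scott continuity in one entry of the environment: a piece of information has a finite
  derivation, which consults only finitely many points of \<open>X\<close>. It supplies the finite
  \<open>a\<close> that \<open>Arr a c\<close> demands even when a denotation is infinite.\<close>

lemma den_continuous:
  "p \<in> den_val V (\<rho>(k := X)) \<Longrightarrow> \<exists>a. set a \<subseteq> X \<and> p \<in> den_val V (\<rho>(k := set a))"
  "c \<in> den_comp M (\<rho>(k := X)) \<Longrightarrow> \<exists>a. set a \<subseteq> X \<and> c \<in> den_comp M (\<rho>(k := set a))"
proof (induction V and M arbitrary: p \<rho> k and c \<rho> k)
  case (Var i)
  show ?case
  proof (cases "i = k")
    case True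
    with Var show ?thesis by (intro exI[of _ "[p]"]) simp
  next
    case False
    with Var show ?thesis by (intro exI[of _ "[]"]) simp
  qed
next
  case (Lam M)
  from Lam.prems obtain a c where p: "p = Arr a c"
    and "c \<in> den_comp M ((case_nat (set a) \<rho>)(Suc k := X))"
    by (simp only: den_val.simps case_nat_upd) blast
  from Lam.IH[OF this(2)] show ?case
    unfolding p den_val.simps case_nat_upd by blast
next
  case (Ret V)
  \<comment> \<open>Each of the finitely many points of \<open>c\<close> has its own finite support;
    monotonicity allows appending them all.\<close>
  have "set c \<subseteq> den_val V (\<rho>(k := X))
    \<Longrightarrow> \<exists>a. set a \<subseteq> X \<and> set c \<subseteq> den_val V (\<rho>(k := set a))"
  proof (induction c)
    case Nil
    show ?case by (intro exI[of _ "[]"]) simp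
  next
    case (Cons p c)
    then obtain a where a: "set a \<subseteq> X" "set c \<subseteq> den_val V (\<rho>(k := set a))"
      by (auto simp del: fun_upd_apply)
    have "p \<in> den_val V (\<rho>(k := X))"
      using Cons.prems by (simp del: fun_upd_apply)
    from Ret.IH[OF this] obtain b where b: "set b \<subseteq> X" "p \<in> den_val V (\<rho>(k := set b))"
      by blast
    show ?case
      using a b den_upd_mono(1)[of "set a" "set (a @ b)" V \<rho> k]
        den_upd_mono(1)[of "set b" "set (a @ b)" V \<rho> k]
      by (intro exI[of _ "a @ b"]) (auto simp del: fun_upd_apply)
  qed
  with Ret.prems show ?case by (simp del: fun_upd_apply)
next
  case (App V M)
  from App.prems obtain a c' where "a \<in> den_comp M (\<rho>(k := X))"
    and c': "set c \<subseteq> set c'" and "Arr a c' \<in> den_val V (\<rho>(k := X))"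
    by (auto simp del: fun_upd_apply)
  from App.IH(2)[OF this(1)] App.IH(1)[OF this(3)]
  obtain d e where d: "set d \<subseteq> X" "a \<in> den_comp M (\<rho>(k := set d))"
    and e: "set e \<subseteq> X" "Arr a c' \<in> den_val V (\<rho>(k := set e))"
    by blast
  have "a \<in> den_comp M (\<rho>(k := set (d @ e)))" "Arr a c' \<in> den_val V (\<rho>(k := set (d @ e)))"
    using d e den_upd_mono(2)[of "set d" "set (d @ e)" M \<rho> k]
      den_upd_mono(1)[of "set e" "set (d @ e)" V \<rho> k]
    by (auto simp del: fun_upd_apply)
  with d e c' show ?case by (intro exI[of _ "d @ e"]) (auto simp del: fun_upd_apply)
qed

section \<open>Soundness\<close>

text \<open>The redex sees only finite parts \<open>a\<close> of the argument's denotation, the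
  contractum all of it. Monotonicity gives one inclusion, continuity the other.\<close>

lemma den_beta_c: "beta_c M N \<Longrightarrow> den_comp M \<rho> = den_comp N \<rho>"
proof (induction rule: beta_c.induct)
  case (1 M V)
  \<comment> \<open>The entry \<open>{}\<close> is a placeholder, overwritten at once; this form
    fits the lemmas on updates.\<close>
  have upd: "case_nat A \<rho> = (case_nat {} \<rho>)(0 := A)" for A
    by (rule ext) (auto split: nat.split)
  show ?case
  proof (intro equalityI subsetI)
    fix c assume "c \<in> den_comp (App (Lam M) (Ret V)) \<rho>"
    then obtain a c' where "set a \<subseteq> den_val V \<rho>" "set c \<subseteq> set c'"
      "c' \<in> den_comp M (case_nat (set a) \<rho>)"
      by auto
    then show "c \<in> den_comp (subst_comp M V 0) \<rho>"
      using den_upd_mono(2)[of "set a" "den_val V \<rho>" M "case_nat {} \<rho>" 0]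
      by (auto simp: den_subst_0 upd[symmetric] intro: den_comp_antimono)
  next
    fix c assume "c \<in> den_comp (subst_comp M V 0) \<rho>"
    then have "c \<in> den_comp M ((case_nat {} \<rho>)(0 := den_val V \<rho>))"
      by (simp add: den_subst_0 upd[symmetric])
    from den_continuous(2)[OF this] show "c \<in> den_comp (App (Lam M) (Ret V)) \<rho>"
      by (auto simp: upd[symmetric])
  qed
qed

lemma den_id_rule: "id_rule M N \<Longrightarrow> den_comp M \<rho> = den_comp N \<rho>"
  by (induction rule: id_rule.induct) (auto intro: den_comp_antimono)

text \<open>Lifting \<open>Lam N\<close> at 0 lifts its body at 1, so the entry \<open>B\<close> of
  the binder newly crossed in \<open>sigma\<close> is skipped.\<close>

lemma den_lift_1:
  "den_comp (lift_comp N (Suc 0)) (case_nat A (case_nat B \<rho>)) = den_comp N (case_nat A \<rho>)"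
proof -
  have "(\<lambda>i. if i < Suc 0 then case_nat A (case_nat B \<rho>) i else case_nat A (case_nat B \<rho>) (Suc i))
      = case_nat A \<rho>"
    by (rule ext) (auto split: nat.split)
  then show ?thesis by (simp only: den_lift)
qed

text \<open>Both sides chain the same information through \<open>L\<close>, \<open>M\<close> and
  \<open>N\<close>; they differ only in where information is weakened, and downward closure absorbs
  that.\<close>

lemma den_sigma: "sigma M N \<Longrightarrow> den_comp M \<rho> = den_comp N \<rho>"
proof (induction rule: sigma.induct)
  case (1 N M L)
  show ?case
    by (simp add: den_lift_1) (blast intro: den_comp_antimono)
qed

text \<open>The premise ranges over all environments because \<open>CRetLam\<close> and
  \<open>CLam\<close> extend the environment at the hole.\<close>

lemma den_plug:
  "(\<And>\<rho>. den_comp P \<rho> = den_comp Q \<rho>) \<Longrightarrow> den_comp (plug C P) \<rho> = den_comp (plug C Q) \<rho>"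
  by (induction C arbitrary: \<rho>) simp_all

lemma den_core: "core M N \<Longrightarrow> den_comp M \<rho> = den_comp N \<rho>"
  unfolding core_def using den_beta_c den_id_rule den_sigma by blast

lemma den_red:
  assumes "red core M N"
  shows "den_comp M \<rho> = den_comp N \<rho>"
proof -
  from assms obtain C P Q where "core P Q" "M = plug C P" "N = plug C Q"
    unfolding red_def by blast
  then show ?thesis by (simp add: den_plug[OF den_core])
qed

lemma den_reds: "(red core)\<^sup>*\<^sup>* M N \<Longrightarrow> den_comp M \<rho> = den_comp N \<rho>"
  by (induction rule: rtranclp_induct) (simp_all add: den_red)

section \<open>Simultaneous substitution\<close>

lemma lift_lift:
  "i \<le> k \<Longrightarrow> lift_val (lift_val V i) (Suc k) = lift_val (lift_val V k) i"
  "i \<le> k \<Longrightarrow> lift_comp (lift_comp M i) (Suc k) = lift_comp (lift_comp M k) i"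
  by (induction V and M arbitrary: i k and i k) auto

lemma subst_lift_same [simp]:
  "subst_val (lift_val V k) U k = V"
  "subst_comp (lift_comp M k) U k = M"
  by (induction V and M arbitrary: k U and k U) auto

lemma subst_lift:
  "i \<le> k \<Longrightarrow> subst_val (lift_val V i) (lift_val U i) (Suc k) = lift_val (subst_val V U k) i"
  "i \<le> k \<Longrightarrow> subst_comp (lift_comp M i) (lift_val U i) (Suc k) = lift_comp (subst_comp M U k) i"
  by (induction V and M arbitrary: i k U and i k U) (auto simp: lift_lift[symmetric])

definition up :: "(nat \<Rightarrow> val) \<Rightarrow> nat \<Rightarrow> val" where
  "up \<theta> = case_nat (Var 0) (\<lambda>i. lift_val (\<theta> i) 0)"

primrec msubst_val :: "val \<Rightarrow> (nat \<Rightarrow> val) \<Rightarrow> val"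
  and msubst_comp :: "comp \<Rightarrow> (nat \<Rightarrow> val) \<Rightarrow> comp"
where
  "msubst_val (Var i) = (\<lambda>\<theta>. \<theta> i)"
| "msubst_val (Lam M) = (\<lambda>\<theta>. Lam (msubst_comp M (up \<theta>)))"
| "msubst_comp (Ret V) = (\<lambda>\<theta>. Ret (msubst_val V \<theta>))"
| "msubst_comp (App V M) = (\<lambda>\<theta>. App (msubst_val V \<theta>) (msubst_comp M \<theta>))"

lemma up_Var [simp]: "up Var = Var"
  by (rule ext) (auto simp: up_def split: nat.split)

lemma msubst_Var [simp]: "msubst_val V Var = V" "msubst_comp M Var = M"
  by (induction V and M) auto

lemma subst_up: "subst_val (up \<theta> i) (lift_val U 0) (Suc k) = up (\<lambda>i. subst_val (\<theta> i) U k) i"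
  by (auto simp: up_def subst_lift split: nat.split)

lemma subst_msubst:
  "subst_val (msubst_val V \<theta>) U k = msubst_val V (\<lambda>i. subst_val (\<theta> i) U k)"
  "subst_comp (msubst_comp M \<theta>) U k = msubst_comp M (\<lambda>i. subst_val (\<theta> i) U k)"
  by (induction V and M arbitrary: \<theta> U k and \<theta> U k) (auto simp: subst_up)

text \<open>Contracting a redex whose body was already substituted into amounts to one larger
  simultaneous substitution, the form to which the induction hypothesis for \<open>Lam\<close> in
  \<open>adequacy\<close> applies.\<close>

lemma subst_msubst_up: "subst_comp (msubst_comp M (up \<theta>)) U 0 = msubst_comp M (case_nat U \<theta>)"
proof -
  have "(\<lambda>i. subst_val (up \<theta> i) U 0) = case_nat U \<theta>"
    by (rule ext) (auto simp: up_def split: nat.split)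
  then show ?thesis by (simp add: subst_msubst)
qed

section \<open>Adequacy\<close>

text \<open>A logical relation by recursion on points instead of types. With \<open>c\<close> empty,
  it still demands that the application converge.\<close>

fun realizes :: "val \<Rightarrow> point \<Rightarrow> bool" where
  "realizes V (Arr a c) \<longleftrightarrow> (\<forall>W. (\<forall>p\<in>set a. realizes W p) \<longrightarrow>
    (\<exists>U. (wred beta_c)\<^sup>*\<^sup>* (App V (Ret W)) (Ret U) \<and> (\<forall>p\<in>set c. realizes U p)))"

lemma wred_beta_c: "wred beta_c (App (Lam M) (Ret V)) (subst_comp M V 0)"
  unfolding wred_def by (metis plug.simps(1) weak_Hole beta_c.intros)

lemma wred_App: "wred \<rho> M N \<Longrightarrow> wred \<rho> (App V M) (App V N)"
  unfolding wred_def by (metis plug.simps(3) weak_CApp)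

lemma wreds_App: "(wred \<rho>)\<^sup>*\<^sup>* M N \<Longrightarrow> (wred \<rho>)\<^sup>*\<^sup>* (App V M) (App V N)"
  by (induction rule: rtranclp_induct) (auto intro: rtranclp.rtrancl_into_rtrancl wred_App)

text \<open>The fundamental lemma of the logical relation. Values for the free variables are carried
  by \<open>\<theta>\<close>, so that the induction can enter the body of an abstraction.\<close>

lemma adequacy:
  "\<forall>i. \<forall>p\<in>\<rho> i. realizes (\<theta> i) p \<Longrightarrow> p \<in> den_val V \<rho> \<Longrightarrow> realizes (msubst_val V \<theta>) p"
  "\<forall>i. \<forall>p\<in>\<rho> i. realizes (\<theta> i) p \<Longrightarrow> c \<in> den_comp M \<rho> \<Longrightarrow>
    \<exists>U. (wred beta_c)\<^sup>*\<^sup>* (msubst_comp M \<theta>) (Ret U) \<and> (\<forall>p\<in>set c. realizes U p)"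
proof (induction V and M arbitrary: \<rho> \<theta> p and \<rho> \<theta> c)
  case (Lam M)
  from Lam.prems(2) obtain a c where p: "p = Arr a c"
    and c: "c \<in> den_comp M (case_nat (set a) \<rho>)"
    by auto
  have "\<exists>U. (wred beta_c)\<^sup>*\<^sup>* (App (Lam (msubst_comp M (up \<theta>))) (Ret W)) (Ret U)
      \<and> (\<forall>p\<in>set c. realizes U p)" if W: "\<forall>p\<in>set a. realizes W p" for W
  proof -
    have "\<exists>U. (wred beta_c)\<^sup>*\<^sup>* (msubst_comp M (case_nat W \<theta>)) (Ret U)
        \<and> (\<forall>p\<in>set c. realizes U p)"
      using W Lam.prems(1) c by (intro Lam.IH) (auto split: nat.splits)
    \<comment> \<open>One \<open>beta_c\<close> step prepended to the evaluation of the instantiated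
      body evaluates the application.\<close>
    then show ?thesis
      using wred_beta_c[of "msubst_comp M (up \<theta>)" W]
      by (auto simp: subst_msubst_up intro: converse_rtranclp_into_rtranclp)
  qed
  then show ?case by (simp add: p)
next
  case (Ret V)
  from Ret.IH[OF Ret.prems(1)] Ret.prems(2) show ?case
    by (intro exI[of _ "msubst_val V \<theta>"]) auto
next
  case (App V M)
  from App.prems(2) obtain a c' where a: "a \<in> den_comp M \<rho>"
    and c': "set c \<subseteq> set c'" and V: "Arr a c' \<in> den_val V \<rho>"
    by auto
  obtain W where W: "(wred beta_c)\<^sup>*\<^sup>* (msubst_comp M \<theta>) (Ret W)" "\<forall>p\<in>set a. realizes W p"
    using App.IH(2)[OF App.prems(1) a] by auto
  \<comment> \<open>The argument is evaluated first, in the weak context formed by the function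
    part; its value \<open>W\<close> then feeds the realizer of \<open>Arr a c'\<close>.\<close>
  from App.IH(1)[OF App.prems(1) V] W(2)
  obtain U where U: "(wred beta_c)\<^sup>*\<^sup>* (App (msubst_val V \<theta>) (Ret W)) (Ret U)"
    "\<forall>p\<in>set c'. realizes U p"
    by auto
  from rtranclp_trans[OF wreds_App[OF W(1)] U(1)]
  have "(wred beta_c)\<^sup>*\<^sup>* (msubst_comp (App V M) \<theta>) (Ret U)"
    by simp
  with U(2) c' show ?case by auto
qed auto

lemma den_nonempty_imp_weak_value:
  assumes "c \<in> den_comp M (\<lambda>_. {})"
  shows "\<exists>U. (wred beta_c)\<^sup>*\<^sup>* M (Ret U)"
  \<comment> \<open>The empty environment is realized vacuously, so the identity substitution
    \<open>Var\<close> qualifies and \<open>M\<close> may be open.\<close>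
  using adequacy(2)[of "\<lambda>_. {}" Var c M] assms by auto

lemma wred_beta_c_imp_red_core: "wred beta_c M N \<Longrightarrow> red core M N"
  unfolding wred_def red_def core_def by blast

theorem mainTheorem3:
  fixes M :: comp
  shows "(\<exists>V. (red core)\<^sup>*\<^sup>* M (Ret V)) \<longleftrightarrow> (\<exists>U. (wred beta_c)\<^sup>*\<^sup>* M (Ret U))"
proof
  assume "\<exists>V. (red core)\<^sup>*\<^sup>* M (Ret V)"
  then obtain V where "(red core)\<^sup>*\<^sup>* M (Ret V)" ..
  \<comment> \<open>The empty list asks for no point of \<open>V\<close>, so it belongs to the
    denotation even if \<open>V\<close> denotes the empty set.\<close>
  moreover have "[] \<in> den_comp (Ret V) (\<lambda>_. {})" by simp
  ultimately have "[] \<in> den_comp M (\<lambda>_. {})" by (simp only: den_reds)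
  then show "\<exists>U. (wred beta_c)\<^sup>*\<^sup>* M (Ret U)" by (rule den_nonempty_imp_weak_value)
next
  assume "\<exists>U. (wred beta_c)\<^sup>*\<^sup>* M (Ret U)"
  then show "\<exists>V. (red core)\<^sup>*\<^sup>* M (Ret V)"
    using mono_rtranclp[of "wred beta_c" "red core"] wred_beta_c_imp_red_core by blast
qed

end
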